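(* Let $W\subseteq\{0,1\}^m$ be a nonempty finite set of binary strings of length $m$, and let $\overline W$ be the set of bitwise negations of the strings in $W$. When negation is allowed, the number of strings in $\{0,1\}^m$ representable by $W$ is $2^{|U|}$, where $U$ is the set of equivalence classes of $\{1,\dots,m\}$ derived from $W\cup\overline W$.
   Context: For $x\in\{0,1\}^m$, $b^x_i$ denotes its $i$-th bit. For $i\in\{1,\dots,m\}$ let $T_i=\{x\in W\cup\overline W \mid b^x_i=0\}$. The equivalence relation $\sim$ on $\{1,\dots,m\}$ derived from $W\cup\overline W$ is given by $i\sim j$ if and only if $T_i=T_j$, and $U$ is the set of its equivalence classes. A string $s\in\{0,1\}^m$ is representable by $W$ when negation is allowed if there is a formula built with the operators bitwise AND $\wedge$, bitwise OR $\vee$ and bitwise negation, whose operands are (at least one, possibly repeated) elements of $W$, which evaluates to $s$. *)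

theory Defs
  imports Main
begin

definition bit_strings :: "nat \<Rightarrow> bool list set" where
  "bit_strings m = {x. length x = m}"

text \<open>Bit positions of a string of length \<open>m\<close> are \<open>1, \<dots>, m\<close>, whereas list indices start at 0.
  The bit value 0 is \<open>False\<close>.\<close>

definition bit_of :: "bool list \<Rightarrow> nat \<Rightarrow> bool" where
  "bit_of x i = x ! (i - 1)"

definition bw_not :: "bool list \<Rightarrow> bool list" where
  "bw_not x = map Not x"

definition bw_and :: "bool list \<Rightarrow> bool list \<Rightarrow> bool list" where
  "bw_and x y = map2 (\<and>) x y"

definition bw_or :: "bool list \<Rightarrow> bool list \<Rightarrow> bool list" where
  "bw_or x y = map2 (\<or>) x y"

text \<open>A formula has at least one operand, since \<open>Operand\<close> is the only non-recursive constructor;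
  \<open>operands F\<close> is the set of operands occurring in \<open>F\<close>.\<close>

datatype (operands: 'a) formula =
    Operand 'a
  | And "'a formula" "'a formula"
  | Or "'a formula" "'a formula"
  | Neg "'a formula"

primrec eval_formula :: "bool list formula \<Rightarrow> bool list" where
  "eval_formula (Operand x) = x"
| "eval_formula (And F G) = bw_and (eval_formula F) (eval_formula G)"
| "eval_formula (Or F G) = bw_or (eval_formula F) (eval_formula G)"
| "eval_formula (Neg F) = bw_not (eval_formula F)"

definition representable :: "bool list set \<Rightarrow> bool list \<Rightarrow> bool" where
  "representable W s \<longleftrightarrow> (\<exists>F. operands F \<subseteq> W \<and> eval_formula F = s)"

text \<open>In the following, \<open>V\<close> is the set of strings from which the equivalence relation on the
  bit positions is derived; negation is accounted for by taking \<open>V = W \<union> bw_not ` W\<close>.\<close>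

definition zero_strings :: "bool list set \<Rightarrow> nat \<Rightarrow> bool list set" where
  "zero_strings V i = {x \<in> V. bit_of x i = False}"

definition position_rel :: "nat \<Rightarrow> bool list set \<Rightarrow> (nat \<times> nat) set" where
  "position_rel m V =
     {(i, j). i \<in> {1..m} \<and> j \<in> {1..m} \<and> zero_strings V i = zero_strings V j}"

lemma equiv_position_rel: "equiv {1..m} (position_rel m V)"
  by (rule equivI) (auto simp: position_rel_def refl_on_def sym_def trans_def)

definition position_classes :: "nat \<Rightarrow> bool list set \<Rightarrow> nat set set" where
  "position_classes m V = {1..m} // position_rel m V"

end

theory Submission
  imports Defs
begin

text \<open>A string of length \<open>m\<close> is representable iff its bits are constant on the equivalence
  classes of positions. Necessity is an induction on formulas. For sufficiency, the conjunction over
  \<open>w \<in> W\<close> of whichever of \<open>w\<close> and its negation has bit 1 at position \<open>i\<close> is the indicator of the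
  class of \<open>i\<close>, and a string that is constant on classes is a disjunction of such indicators (the
  zero string being \<open>w \<and> \<not> w\<close>). The strings that are constant on classes correspond to the sets of
  classes.\<close>

text \<open>The subsets of \<open>A\<close> closed under \<open>r\<close> are exactly the unions of
  classes, and a set of classes can be recovered from its union because classes are nonempty and
  pairwise disjoint. So they are counted by the power set of \<open>A // r\<close>.\<close>

lemma card_saturated_subsets:
  assumes "equiv A r" "finite A"
  shows "card {S. S \<subseteq> A \<and> r `` S \<subseteq> S} = 2 ^ card (A // r)"
proof -
  have inj: "inj_on Union (Pow (A // r))"
  proof (rule inj_onI)
    have sub: "C \<subseteq> D" if CD: "C \<subseteq> A // r" "D \<subseteq> A // r" "\<Union> C = \<Union> D" for C D
    proof
      fix X assume X: "X \<in> C"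
      then obtain x where x: "x \<in> X"
        using CD(1) in_quotient_imp_non_empty[OF assms(1)] by blast
      then obtain Y where "Y \<in> D" "x \<in> Y" using X CD(3) by blast
      \<comment> \<open>Both classes contain \<open>x\<close>, and two classes are either equal or
        disjoint.\<close>
      then have "X = Y"
        using quotient_disj[OF assms(1), of X Y] X x CD(1,2) by blast
      then show "X \<in> D" using \<open>Y \<in> D\<close> by simp
    qed
    fix C D assume "C \<in> Pow (A // r)" "D \<in> Pow (A // r)" "\<Union> C = \<Union> D"
    then show "C = D" using sub[of C D] sub[of D C] by simp
  qed
  have "Union ` Pow (A // r) = {S. S \<subseteq> A \<and> r `` S \<subseteq> S}"
  proof (intro equalityI subsetI)
    fix S assume "S \<in> Union ` Pow (A // r)"
    then obtain C where C: "C \<subseteq> A // r" "S = \<Union> C" by auto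
    have "X \<subseteq> A \<and> r `` X \<subseteq> X" if "X \<in> C" for X
    proof -
      have "X \<in> A // r" using that C(1) by blast
      then show ?thesis
        using in_quotient_imp_subset[OF assms(1)] in_quotient_imp_closed[OF assms(1)] by blast
    qed
    then show "S \<in> {S. S \<subseteq> A \<and> r `` S \<subseteq> S}" unfolding C(2) by blast
  next
    fix S assume S: "S \<in> {S. S \<subseteq> A \<and> r `` S \<subseteq> S}"
    \<comment> \<open>Reflexivity puts each point of \<open>S\<close> into its own class; closure
      under \<open>r\<close> keeps these classes inside \<open>S\<close>.\<close>
    have "S = \<Union> ((\<lambda>x. r `` {x}) ` S)"
      using S equiv_class_self[OF assms(1)] by blast
    moreover have "(\<lambda>x. r `` {x}) ` S \<in> Pow (A // r)"
      using S by (auto intro: quotientI)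
    ultimately show "S \<in> Union ` Pow (A // r)" by (rule image_eqI)
  qed
  then have "card {S. S \<subseteq> A \<and> r `` S \<subseteq> S} = card (Pow (A // r))"
    using card_image[OF inj] by simp
  also have "\<dots> = 2 ^ card (A // r)"
    by (rule card_Pow) (use assms in \<open>auto simp: finite_quotient equiv_type\<close>)
  finally show ?thesis .
qed

lemma bit_strings_eqI:
  assumes "s \<in> bit_strings m" "t \<in> bit_strings m" "\<And>i. i \<in> {1..m} \<Longrightarrow> bit_of s i = bit_of t i"
  shows "s = t"
proof (rule nth_equalityI)
  show "length s = length t" using assms by (simp add: bit_strings_def)
  fix k assume "k < length s"
  \<comment> \<open>List index \<open>k\<close> is bit position \<open>Suc k\<close>.\<close>
  then show "s ! k = t ! k"
    using assms(1) assms(3)[of "Suc k"] by (simp add: bit_strings_def bit_of_def)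
qed

lemma bit_of_bw [simp]:
  assumes "x \<in> bit_strings m" "i \<in> {1..m}"
  shows "bit_of (bw_not x) i \<longleftrightarrow> \<not> bit_of x i"
    and "y \<in> bit_strings m \<Longrightarrow> bit_of (bw_and x y) i \<longleftrightarrow> bit_of x i \<and> bit_of y i"
    and "y \<in> bit_strings m \<Longrightarrow> bit_of (bw_or x y) i \<longleftrightarrow> bit_of x i \<or> bit_of y i"
  using assms by (auto simp: bit_of_def bw_not_def bw_and_def bw_or_def bit_strings_def)

lemma bw_closed [simp]:
  assumes "x \<in> bit_strings m"
  shows "bw_not x \<in> bit_strings m"
    and "y \<in> bit_strings m \<Longrightarrow> bw_and x y \<in> bit_strings m"
    and "y \<in> bit_strings m \<Longrightarrow> bw_or x y \<in> bit_strings m"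
  using assms by (auto simp: bw_not_def bw_and_def bw_or_def bit_strings_def)

text \<open>Reading a string as the set of its 1-positions turns the count of strings into a count
  of subsets of \<open>{1..m}\<close>. The inverse has to shift by one, since list index
  \<open>k\<close> holds position \<open>Suc k\<close>.\<close>

lemma bij_betw_one_positions:
  "bij_betw (\<lambda>s. {i \<in> {1..m}. bit_of s i}) (bit_strings m) (Pow {1..m})"
proof (rule bij_betwI')
  fix s t assume "s \<in> bit_strings m" "t \<in> bit_strings m"
  then show "({i \<in> {1..m}. bit_of s i} = {i \<in> {1..m}. bit_of t i}) = (s = t)"
    using bit_strings_eqI[of s m t] by blast
next
  fix S :: "nat set" assume "S \<in> Pow {1..m}"
  moreover have "bit_of (map (\<lambda>k. Suc k \<in> S) [0..<m]) i \<longleftrightarrow> i \<in> S" if "i \<in> {1..m}" for i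
    using that by (cases i) (auto simp: bit_of_def)
  ultimately have "S = {i \<in> {1..m}. bit_of (map (\<lambda>k. Suc k \<in> S) [0..<m]) i}"
    by blast
  then show "\<exists>s \<in> bit_strings m. S = {i \<in> {1..m}. bit_of s i}"
    by (intro bexI[of _ "map (\<lambda>k. Suc k \<in> S) [0..<m]"]) (auto simp: bit_strings_def)
qed auto

lemma representable_intros:
  shows representable_operand: "w \<in> W \<Longrightarrow> representable W w"
    and representable_not: "representable W x \<Longrightarrow> representable W (bw_not x)"
    and representable_and:
      "representable W x \<Longrightarrow> representable W y \<Longrightarrow> representable W (bw_and x y)"
    and representable_or:
      "representable W x \<Longrightarrow> representable W y \<Longrightarrow> representable W (bw_or x y)"
proof -
  show "representable W w" if "w \<in> W"
    using that unfolding representable_def by (intro exI[of _ "Operand w"]) simp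
  show "representable W (bw_not x)" if "representable W x"
  proof -
    from that obtain F where "operands F \<subseteq> W" "eval_formula F = x"
      unfolding representable_def by blast
    then show ?thesis unfolding representable_def by (intro exI[of _ "Neg F"]) simp
  qed
  assume "representable W x" "representable W y"
  then obtain F G where "operands F \<subseteq> W" "eval_formula F = x" "operands G \<subseteq> W" "eval_formula G = y"
    unfolding representable_def by blast
  then show "representable W (bw_and x y)" "representable W (bw_or x y)"
    unfolding representable_def
    by - (rule exI[of _ "And F G"], simp, rule exI[of _ "Or F G"], simp)
qed

text \<open>Structural induction on a formula for \<open>s\<close>, phrased on values so that
  formulas need not appear in its use.\<close>

lemma representable_induct [consumes 1, case_names Operand Not And Or]:
  assumes "representable W s"
    and "\<And>w. w \<in> W \<Longrightarrow> P w"
    and "\<And>x. P x \<Longrightarrow> P (bw_not x)"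
    and "\<And>x y. P x \<Longrightarrow> P y \<Longrightarrow> P (bw_and x y)"
    and "\<And>x y. P x \<Longrightarrow> P y \<Longrightarrow> P (bw_or x y)"
  shows "P s"
proof -
  have "operands F \<subseteq> W \<Longrightarrow> P (eval_formula F)" for F
    by (induction F) (auto intro: assms(2-))
  then show ?thesis using assms(1) by (auto simp: representable_def)
qed

text \<open>Equality of the sets of zero strings says that every string has equal bits at
  \<open>i\<close> and \<open>j\<close>. The negated strings add no condition, since negation flips
  both bits.\<close>

lemma position_rel_iff:
  assumes "W \<subseteq> bit_strings m"
  shows "(i, j) \<in> position_rel m (W \<union> bw_not ` W) \<longleftrightarrow>
    i \<in> {1..m} \<and> j \<in> {1..m} \<and> (\<forall>w \<in> W. bit_of w i = bit_of w j)"
proof -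
  let ?V = "W \<union> bw_not ` W"
  have "zero_strings ?V i = zero_strings ?V j \<longleftrightarrow> (\<forall>w \<in> W. bit_of w i = bit_of w j)"
    if ij: "i \<in> {1..m}" "j \<in> {1..m}"
  proof -
    have "zero_strings ?V i = zero_strings ?V j \<longleftrightarrow> (\<forall>x \<in> ?V. bit_of x i = bit_of x j)"
      by (auto simp: zero_strings_def)
    also have "\<dots> \<longleftrightarrow> (\<forall>w \<in> W. bit_of w i = bit_of w j \<and> bit_of (bw_not w) i = bit_of (bw_not w) j)"
      by auto
    also have "\<dots> \<longleftrightarrow> (\<forall>w \<in> W. bit_of w i = bit_of w j)"
      using bit_of_bw(1)[OF subsetD[OF assms]] ij by (intro ball_cong) auto
    finally show ?thesis .
  qed
  then show ?thesis by (auto simp: position_rel_def)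
qed

text \<open>The induction starts at a singleton, so no all-ones string has to be built. This
  suffices for conjunctions indexed by the nonempty \<open>W\<close>.\<close>

lemma representable_Conj:
  assumes "finite A" "A \<noteq> {}"
    and "\<And>a. a \<in> A \<Longrightarrow> f a \<in> bit_strings m \<and> representable W (f a)"
  shows "\<exists>t \<in> bit_strings m. representable W t \<and>
    (\<forall>j \<in> {1..m}. bit_of t j \<longleftrightarrow> (\<forall>a \<in> A. bit_of (f a) j))"
  using assms
proof (induction A rule: finite_ne_induct)
  case (singleton a)
  then show ?case by auto
next
  case (insert a A)
  have "\<exists>t \<in> bit_strings m. representable W t \<and>
      (\<forall>j \<in> {1..m}. bit_of t j \<longleftrightarrow> (\<forall>a \<in> A. bit_of (f a) j))"
    by (rule insert.IH) (simp add: insert.prems)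
  then obtain t where t: "t \<in> bit_strings m" "representable W t"
    "\<forall>j \<in> {1..m}. bit_of t j \<longleftrightarrow> (\<forall>a \<in> A. bit_of (f a) j)"
    by blast
  have fa: "f a \<in> bit_strings m" "representable W (f a)"
    using insert.prems[of a] by auto
  show ?case
  proof (intro bexI[of _ "bw_and (f a) t"] conjI ballI)
    show "representable W (bw_and (f a) t)" using fa t by (intro representable_and)
    show "bw_and (f a) t \<in> bit_strings m" using fa t by simp
    fix j assume j: "j \<in> {1..m}"
    show "bit_of (bw_and (f a) t) j \<longleftrightarrow> (\<forall>a \<in> insert a A. bit_of (f a) j)"
      using t(3) j by (simp add: bit_of_bw[OF fa(1) j] t(1))
  qed
qed

text \<open>Here \<open>A\<close> may be empty, because it will be the set of 1-positions of a
  string that may be zero.\<close>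

lemma representable_Disj:
  assumes "W \<subseteq> bit_strings m" "W \<noteq> {}" "finite A"
    and "\<And>a. a \<in> A \<Longrightarrow> f a \<in> bit_strings m \<and> representable W (f a)"
  shows "\<exists>t \<in> bit_strings m. representable W t \<and>
    (\<forall>j \<in> {1..m}. bit_of t j \<longleftrightarrow> (\<exists>a \<in> A. bit_of (f a) j))"
  using assms(3-)
proof (induction A rule: finite_induct)
  case empty
  obtain w where w: "w \<in> W" "w \<in> bit_strings m" using assms(1,2) by blast
  then show ?case
    \<comment> \<open>A string meets its own negation in the zero string, the value of the empty
      disjunction.\<close>
    by (intro bexI[of _ "bw_and w (bw_not w)"])
      (auto intro: representable_intros)
next
  case (insert a A)
  have "\<exists>t \<in> bit_strings m. representable W t \<and>
      (\<forall>j \<in> {1..m}. bit_of t j \<longleftrightarrow> (\<exists>a \<in> A. bit_of (f a) j))"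
    by (rule insert.IH) (simp add: insert.prems)
  then obtain t where t: "t \<in> bit_strings m" "representable W t"
    "\<forall>j \<in> {1..m}. bit_of t j \<longleftrightarrow> (\<exists>a \<in> A. bit_of (f a) j)"
    by blast
  have fa: "f a \<in> bit_strings m" "representable W (f a)"
    using insert.prems[of a] by auto
  show ?case
  proof (intro bexI[of _ "bw_or (f a) t"] conjI ballI)
    show "representable W (bw_or (f a) t)" using fa t by (intro representable_or)
    show "bw_or (f a) t \<in> bit_strings m" using fa t by simp
    fix j assume j: "j \<in> {1..m}"
    show "bit_of (bw_or (f a) t) j \<longleftrightarrow> (\<exists>a \<in> insert a A. bit_of (f a) j)"
      using t(3) j by (simp add: bit_of_bw[OF fa(1) j] t(1))
  qed
qed

lemma representable_iff_constant_on_classes: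
  assumes W: "W \<subseteq> bit_strings m" "W \<noteq> {}" "finite W" and s: "s \<in> bit_strings m"
  shows "representable W s \<longleftrightarrow>
    (\<forall>(i, j) \<in> position_rel m (W \<union> bw_not ` W). bit_of s i = bit_of s j)"
    (is "_ \<longleftrightarrow> (\<forall>(i, j) \<in> ?r. _)")
proof
  assume "representable W s"
  \<comment> \<open>Membership in \<open>bit_strings m\<close> is carried through the induction,
    since the bitwise rules for \<open>bit_of\<close> require it of the operands.\<close>
  then have "s \<in> bit_strings m \<and> bit_of s i = bit_of s j" if "(i, j) \<in> ?r" for i j
  proof (induction rule: representable_induct)
    case (Operand w)
    then show ?case using that W(1) by (auto simp: position_rel_iff)
  qed (use that in \<open>auto simp: position_rel_iff[OF W(1)]\<close>)
  then show "\<forall>(i, j) \<in> ?r. bit_of s i = bit_of s j" by blast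
next
  assume const: "\<forall>(i, j) \<in> ?r. bit_of s i = bit_of s j"
  have "\<exists>t \<in> bit_strings m. representable W t \<and>
      (\<forall>j \<in> {1..m}. bit_of t j \<longleftrightarrow> (i, j) \<in> ?r)" if "i \<in> {1..m}" for i
  proof -
    let ?f = "\<lambda>w. if bit_of w i then w else bw_not w"
    have "\<exists>t \<in> bit_strings m. representable W t \<and>
        (\<forall>j \<in> {1..m}. bit_of t j \<longleftrightarrow> (\<forall>w \<in> W. bit_of (?f w) j))"
      by (rule representable_Conj[OF W(3,2)])
        (use W(1) in \<open>auto intro: representable_operand representable_not\<close>)
    then obtain t where t: "t \<in> bit_strings m" "representable W t"
      "\<forall>j \<in> {1..m}. bit_of t j \<longleftrightarrow> (\<forall>w \<in> W. bit_of (?f w) j)"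
      by blast
    \<comment> \<open>By its choice \<open>?f w\<close> has bit 1 at \<open>i\<close>, so it has bit
      1 at \<open>j\<close> exactly when \<open>w\<close> does not separate \<open>i\<close> from
      \<open>j\<close>.\<close>
    have "bit_of (?f w) j \<longleftrightarrow> bit_of w i = bit_of w j" if "w \<in> W" "j \<in> {1..m}" for w j
      using bit_of_bw(1)[of w m j] that W(1) by auto
    then have "\<forall>j \<in> {1..m}. bit_of t j \<longleftrightarrow> (i, j) \<in> ?r"
      using t(3) \<open>i \<in> {1..m}\<close> by (simp add: position_rel_iff[OF W(1)])
    then show ?thesis using t(1,2) by blast
  qed
  then obtain a where a: "\<And>i. i \<in> {1..m} \<Longrightarrow> a i \<in> bit_strings m \<and> representable W (a i)"
    "\<And>i j. i \<in> {1..m} \<Longrightarrow> j \<in> {1..m} \<Longrightarrow> bit_of (a i) j \<longleftrightarrow> (i, j) \<in> ?r"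
    by metis
  \<comment> \<open>Join the class indicators \<open>a i\<close> over all 1-positions
    \<open>i\<close> of \<open>s\<close>.\<close>
  have "\<exists>t \<in> bit_strings m. representable W t \<and>
      (\<forall>j \<in> {1..m}. bit_of t j \<longleftrightarrow> (\<exists>i \<in> {i \<in> {1..m}. bit_of s i}. bit_of (a i) j))"
    by (rule representable_Disj[OF W(1,2)]) (simp_all add: a(1))
  then obtain t where t: "t \<in> bit_strings m" "representable W t"
    "\<forall>j \<in> {1..m}. bit_of t j \<longleftrightarrow> (\<exists>i \<in> {i \<in> {1..m}. bit_of s i}. bit_of (a i) j)"
    by blast
  have "s = t"
  proof (rule bit_strings_eqI[OF s t(1)])
    fix j assume j: "j \<in> {1..m}"
    then have "(j, j) \<in> ?r" by (simp add: position_rel_def)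
    \<comment> \<open>A 1-position of \<open>s\<close> lies in its own class, so it is one of
      \<open>t\<close>; conversely, a 1 of \<open>t\<close> at \<open>j\<close> comes from a related
      1-position of \<open>s\<close>, and \<open>const\<close> carries it to
      \<open>j\<close>.\<close>
    then show "bit_of s j = bit_of t j" using j t(3) a(2) const by blast
  qed
  then show "representable W s" using t(2) by simp
qed

theorem theorem7p2:
  fixes m :: nat and W :: "bool list set"
  assumes "W \<subseteq> bit_strings m" and "W \<noteq> {}" and "finite W"
  shows "card {s \<in> bit_strings m. representable W s}
           = 2 ^ card (position_classes m (W \<union> bw_not ` W))"
proof -
  let ?r = "position_rel m (W \<union> bw_not ` W)"
  let ?ones = "\<lambda>s. {i \<in> {1..m}. bit_of s i}"
  have eq: "equiv {1..m} ?r" by (rule equiv_position_rel)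
  have "?r `` ?ones s \<subseteq> ?ones s \<longleftrightarrow> representable W s" if "s \<in> bit_strings m" for s
  proof -
    have "?r `` ?ones s \<subseteq> ?ones s \<longleftrightarrow> (\<forall>(i, j) \<in> ?r. bit_of s i \<longrightarrow> bit_of s j)"
      by (auto simp: position_rel_def)
    \<comment> \<open>As \<open>?r\<close> is symmetric, the implication holds in both
      directions.\<close>
    also have "\<dots> \<longleftrightarrow> (\<forall>(i, j) \<in> ?r. bit_of s i = bit_of s j)"
      using equivE[OF eq] unfolding sym_def by blast
    finally show ?thesis
      by (simp only: representable_iff_constant_on_classes[OF assms that])
  qed
  \<comment> \<open>Representable strings thus correspond to the \<open>?r\<close>-closed sets of
    positions, which \<open>card_saturated_subsets\<close> counts.\<close>
  then have "bij_betw ?ones {s \<in> bit_strings m. representable W s}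
      {S \<in> Pow {1..m}. ?r `` S \<subseteq> S}"
    by (intro bij_betw_Collect[OF bij_betw_one_positions]) auto
  then show ?thesis
    using card_saturated_subsets[OF eq] unfolding position_classes_def
    by (simp add: bij_betw_same_card)
qed

end
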